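(* Let $n\ge 2$ be an integer, and let $d_3(n,2)$ be the largest $d$ such that there is a ternary LCD $[n,2,d]$ code. Then $$d_3(n,2)=\begin{cases}\left\lfloor \frac{3n}{4}\right\rfloor & \text{if } n\equiv 1,2 \pmod 4,\\[2pt] \left\lfloor \frac{3n}{4}\right\rfloor-1 & \text{if } n\equiv 0,3 \pmod 4.\end{cases}$$
   Context: A ternary $[n,k,d]$ code is a $k$-dimensional subspace $C$ of $\mathbb{F}_3^n$ whose minimum weight (the smallest Hamming weight of a nonzero codeword) is exactly $d$. With $C^\perp=\{x\in\mathbb{F}_3^n: x\cdot y=0 \text{ for all } y\in C\}$ for the standard inner product, $C$ is LCD (linear complementary dual) if $C\cap C^\perp=\{0\}$. *)

theory Defs
  imports Complex_Main "Jordan_Normal_Form.VS_Connect"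
begin

text \<open>
  The distribution type \<open>Enum.finite_3\<close> carries a \<open>field\<close> instance; as it has exactly three
  elements, it is the prime field with three elements.
\<close>

type_synonym gf3 = Enum.finite_3

lemma CARD_gf3: "card (UNIV :: gf3 set) = 3"
  by (simp add: UNIV_finite_3)

lemma UNIV_gf3: "(UNIV :: gf3 set) = {0, 1, -1}"
  by (auto simp: UNIV_finite_3 uminus_finite_3_def)

definition hamming_weight :: "'a :: zero vec \<Rightarrow> nat" where
  "hamming_weight v = card {i. i < dim_vec v \<and> v $ i \<noteq> 0}"

text \<open>The zero code has no minimum weight: the predicate below is then false for every \<open>d\<close>.\<close>

definition has_min_weight :: "nat \<Rightarrow> 'a :: zero vec set \<Rightarrow> nat \<Rightarrow> bool" where
  "has_min_weight n C d \<longleftrightarrow>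
     (\<exists>c \<in> C - {0\<^sub>v n}. hamming_weight c = d) \<and>
     (\<forall>c \<in> C - {0\<^sub>v n}. d \<le> hamming_weight c)"

definition ternary_code :: "nat \<Rightarrow> nat \<Rightarrow> nat \<Rightarrow> gf3 vec set \<Rightarrow> bool" where
  "ternary_code n k d C \<longleftrightarrow>
     subspace class_ring C (module_vec TYPE(gf3) n) \<and>
     vectorspace.dim class_ring ((module_vec TYPE(gf3) n)\<lparr>carrier := C\<rparr>) = k \<and>
     has_min_weight n C d"

definition dual_code :: "nat \<Rightarrow> 'a :: semiring_0 vec set \<Rightarrow> 'a vec set" where
  "dual_code n C = {x \<in> carrier_vec n. \<forall>y \<in> C. x \<bullet> y = 0}"

definition LCD :: "nat \<Rightarrow> 'a :: semiring_0 vec set \<Rightarrow> bool" where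
  "LCD n C \<longleftrightarrow> C \<inter> dual_code n C = {0\<^sub>v n}"

text \<open>
  The set below is finite, so \<open>d\<^sub>3 n k\<close> is a genuine maximum whenever a ternary LCD \<open>[n,k]\<close> code
  with \<open>k \<ge> 1\<close> exists; otherwise the value is unspecified.
\<close>

definition d\<^sub>3 :: "nat \<Rightarrow> nat \<Rightarrow> nat" where
  "d\<^sub>3 n k = Max {d. \<exists>C. ternary_code n k d C \<and> LCD n C}"

lemma finite_LCD_min_weights: "finite {d. \<exists>C. ternary_code n k d C \<and> LCD n C}"
proof (rule finite_subset)
  show "{d. \<exists>C. ternary_code n k d C \<and> LCD n C} \<subseteq> {..n}"
  proof
    fix d assume "d \<in> {d. \<exists>C. ternary_code n k d C \<and> LCD n C}"
    then obtain C where code: "ternary_code n k d C" by blast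
    interpret vec_space "TYPE(gf3)" n .
    from code have "C \<subseteq> carrier_vec n"
      by (auto simp: ternary_code_def subspace_def submodule_def)
    moreover from code obtain c where "c \<in> C" and d: "hamming_weight c = d"
      by (auto simp: ternary_code_def has_min_weight_def)
    ultimately have "dim_vec c = n" by auto
    then have "hamming_weight c \<le> card {..<n}"
      unfolding hamming_weight_def by (intro card_mono) auto
    with d show "d \<in> {..n}" by simp
  qed
qed simp

end

theory Submission
  imports Defs
begin

text \<open>
  A two-dimensional code is the plane of all combinations \<open>a u + b v\<close> of two independent words, and
  it is LCD exactly if the Gram determinant \<open>(u \<bullet> u) (v \<bullet> v) - (u \<bullet> v)\<^sup>2\<close> is nonzero
  (\<open>LCD_plane_iff\<close>). Up to sign, its nonzero words are \<open>u\<close>, \<open>v\<close>, \<open>u + v\<close> and \<open>u - v\<close>, so these four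
  weights determine the minimum weight. They also determine the Gram determinant: a nonzero element
  of the field with three elements has square 1, so \<open>x \<bullet> x\<close> is the weight of \<open>x\<close> modulo 3, and
  \<open>u \<bullet> v\<close> follows from the weights of \<open>u\<close>, \<open>v\<close> and \<open>u + v\<close> by polarization
  (\<open>gram_det_eq_weights\<close>).

  Upper bound (\<open>min_weight_le\<close>): a coordinate at which \<open>u\<close> and \<open>v\<close> do not both vanish is zero in
  exactly one of the four words, so the four weights add up to at most \<open>3 n\<close>, and to a multiple of 3
  (\<open>four_weights_sum\<close>). Hence the smallest one is at most \<open>\<lfloor>3 n / 4\<rfloor>\<close>. If equality holds and
  \<open>n = 4 m\<close>, all four weights are \<open>3 m\<close> and the code is self-orthogonal. If equality holds and
  \<open>n = 4 m + 3\<close>, one weight is \<open>3 m + 3\<close> and three are \<open>3 m + 2\<close>; by polarization the word of weight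
  \<open>3 m + 3\<close> is orthogonal to the whole code. In both cases the code is not LCD.

  Lower bound (\<open>optimal_pair_exists\<close>): prepending the self-orthogonal tetracode, in which all nonzero
  words have weight 3, to a code raises the length by 4 and every nonzero weight by 3, and leaves the
  Gram determinant unchanged. As the claimed value also grows by 3 when \<open>n\<close> grows by 4, it suffices
  to give optimal codes of lengths 2, 3, 4 and 5.
\<close>

section \<open>Two-dimensional subspaces and their generating pairs\<close>

definition plane :: "'a :: semiring_0 vec \<Rightarrow> 'a vec \<Rightarrow> 'a vec set" where
  "plane u v = {a \<cdot>\<^sub>v u + b \<cdot>\<^sub>v v | a b. True}"

definition indep_pair :: "nat \<Rightarrow> 'a :: semiring_0 vec \<Rightarrow> 'a vec \<Rightarrow> bool" where
  "indep_pair n u v \<longleftrightarrow> (\<forall>a b. a \<cdot>\<^sub>v u + b \<cdot>\<^sub>v v = 0\<^sub>v n \<longrightarrow> a = 0 \<and> b = 0)"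

definition gram_det :: "'a :: comm_ring_1 vec \<Rightarrow> 'a vec \<Rightarrow> 'a" where
  "gram_det u v = (u \<bullet> u) * (v \<bullet> v) - (u \<bullet> v)\<^sup>2"

context vec_space
begin

lemma lincomb_pair:
  assumes "u \<in> carrier_vec n" "v \<in> carrier_vec n" "u \<noteq> v"
  shows "lincomb a {u, v} = a u \<cdot>\<^sub>v u + a v \<cdot>\<^sub>v v"
  using assms lincomb_insert2[of "{v}" a u] lincomb_insert2[of "{}" a v]
  by (auto simp: lincomb_empty)

lemma span_pair:
  assumes "u \<in> carrier_vec n" "v \<in> carrier_vec n" "u \<noteq> v"
  shows "span {u, v} = plane u v"
proof -
  have "span {u, v} = {lincomb a {u, v} | a. a \<in> {u, v} \<rightarrow> UNIV}"
    using assms finite_span[of "{u, v}"] by simp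
  also have "\<dots> = plane u v"
  proof (intro equalityI subsetI)
    fix x assume "x \<in> plane u v"
    then obtain a b where "x = a \<cdot>\<^sub>v u + b \<cdot>\<^sub>v v"
      by (auto simp: plane_def)
    then have "x = lincomb (\<lambda>w. if w = u then a else b) {u, v}"
      using assms by (simp add: lincomb_pair)
    then show "x \<in> {lincomb a {u, v} | a. a \<in> {u, v} \<rightarrow> UNIV}"
      by blast
  qed (use assms in \<open>auto simp: lincomb_pair plane_def\<close>)
  finally show ?thesis .
qed

lemma lin_indpt_pair_iff:
  assumes "u \<in> carrier_vec n" "v \<in> carrier_vec n" "u \<noteq> v"
  shows "lin_indpt {u, v} \<longleftrightarrow> indep_pair n u v"
proof
  assume li: "lin_indpt {u, v}"
  show "indep_pair n u v"
    unfolding indep_pair_def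
  proof (intro allI impI, rule ccontr)
    fix a b assume ab: "a \<cdot>\<^sub>v u + b \<cdot>\<^sub>v v = 0\<^sub>v n" "\<not> (a = 0 \<and> b = 0)"
    define f where "f = (\<lambda>w. if w = u then a else b)"
    have "lincomb f {u, v} = 0\<^sub>v n"
      using assms ab by (simp add: lincomb_pair f_def)
    moreover have "f u \<noteq> 0 \<or> f v \<noteq> 0"
      using ab assms by (auto simp: f_def)
    ultimately have "lin_dep {u, v}"
      using lin_dep_crit[where A = "{u, v}" and S = "{u, v}" and a = f and v = u]
        lin_dep_crit[where A = "{u, v}" and S = "{u, v}" and a = f and v = v] by auto
    with li show False ..
  qed
next
  assume "indep_pair n u v"
  then show "lin_indpt {u, v}"
    using assms by (intro finite_lin_indpt2) (auto simp: lincomb_pair indep_pair_def)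
qed

lemma indep_pair_distinct:
  fixes u v :: "'a vec"
  assumes "u \<in> carrier_vec n" "v \<in> carrier_vec n" "indep_pair n u v"
  shows "u \<noteq> v"
proof
  assume "u = v"
  then have "1 \<cdot>\<^sub>v u + (- 1) \<cdot>\<^sub>v v = 0\<^sub>v n"
    using assms(2) by (intro eq_vecI) auto
  with assms(3) show False
    unfolding indep_pair_def by (metis one_neq_zero)
qed

text \<open>
  Span and independence do not depend on the ambient space; hence \<open>{u, v}\<close> is a basis of its span.
\<close>

lemma subspace_plane:
  assumes u: "u \<in> carrier_vec n" and v: "v \<in> carrier_vec n" and ind: "indep_pair n u v"
  shows "subspace class_ring (plane u v) V"
    and "vectorspace.dim class_ring (V\<lparr>carrier := plane u v\<rparr>) = 2"
proof -
  note uv = indep_pair_distinct[OF assms]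
  have sp: "span {u, v} = plane u v" by (rule span_pair[OF u v uv])
  show sub: "subspace class_ring (plane u v) V"
    using span_is_subspace[of "{u, v}"] u v by (simp add: sp)
  then interpret W: vectorspace class_ring "V\<lparr>carrier := plane u v\<rparr>"
    by (rule subspace_is_vs)
  have sm: "submodule class_ring (plane u v) V" using sub by (rule is_module)
  have in_plane: "{u, v} \<subseteq> plane u v"
    using in_own_span[of "{u, v}"] u v sp by simp
  have "W.basis {u, v}"
    using span_li_not_depend[OF in_plane sm] in_plane sp ind lin_indpt_pair_iff[OF u v uv]
    by (simp add: W.basis_def)
  then show "W.dim = 2"
    using W.dim_basis[of "{u, v}"] uv by simp
qed

text \<open>
  The dimension is defined as the least size of a generating set, so it carries information only once
  some finite generating set is known; for a finite \<open>C\<close> the whole of \<open>C\<close> is one.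
\<close>

lemma two_dim_subspace_is_plane:
  assumes sub: "subspace class_ring C V"
    and dim: "vectorspace.dim class_ring (V\<lparr>carrier := C\<rparr>) = 2"
    and fin: "finite C"
  obtains u v where "u \<in> carrier_vec n" "v \<in> carrier_vec n" "indep_pair n u v" "C = plane u v"
proof -
  interpret W: vectorspace class_ring "V\<lparr>carrier := C\<rparr>"
    using sub by (rule subspace_is_vs)
  have sm: "submodule class_ring C V" using sub by (rule is_module)
  then have C: "C \<subseteq> carrier_vec n" by (simp add: submodule_def)
  have "W.span C = C"
    using W.in_own_span[of C] W.span_is_subset2[of C] by auto
  then have "W.fin_dim"
    using fin by (auto simp: W.fin_dim_def intro!: exI[of _ C])
  then obtain B where B: "finite B" "W.basis B"
    using W.finite_basis_exists by blast
  with dim have "card B = 2" by (simp add: W.dim_basis)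
  then obtain u v where uv: "u \<noteq> v" and B_eq: "B = {u, v}"
    by (auto simp: card_2_iff)
  have BC: "B \<subseteq> C" using B by (simp add: W.basis_def)
  with C B_eq have u: "u \<in> carrier_vec n" and v: "v \<in> carrier_vec n" by auto
  have "span B = C" "lin_indpt B"
    using B span_li_not_depend[OF BC sm] by (auto simp: W.basis_def)
  then show thesis
    using that[OF u v] lin_indpt_pair_iff[OF u v uv] span_pair[OF u v uv] B_eq by simp
qed

end

section \<open>The Gram criterion for complementary duals\<close>

lemma plane_closed:
  assumes "u \<in> carrier_vec n" "v \<in> carrier_vec n"
  shows "plane u v \<subseteq> carrier_vec n"
  using assms by (auto simp: plane_def)

text \<open>
  Orthogonality to the plane need only be tested on \<open>u\<close> and \<open>v\<close>, which gives a homogeneous linear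
  system for \<open>(a, b)\<close> whose matrix is the Gram matrix.
\<close>

lemma orthogonal_to_plane_iff:
  fixes u v :: "'a :: comm_ring_1 vec"
  assumes "u \<in> carrier_vec n" "v \<in> carrier_vec n"
  shows "a \<cdot>\<^sub>v u + b \<cdot>\<^sub>v v \<in> dual_code n (plane u v) \<longleftrightarrow>
     a * (u \<bullet> u) + b * (u \<bullet> v) = 0 \<and> a * (u \<bullet> v) + b * (v \<bullet> v) = 0" (is "?x \<in> _ \<longleftrightarrow> ?R")
proof -
  have vu: "v \<bullet> u = u \<bullet> v" by (rule comm_scalar_prod[OF assms(2,1)])
  have xu: "?x \<bullet> u = a * (u \<bullet> u) + b * (u \<bullet> v)" and xv: "?x \<bullet> v = a * (u \<bullet> v) + b * (v \<bullet> v)"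
    using assms vu by (simp_all add: add_scalar_prod_distrib[of _ n])
  have lin: "?x \<bullet> (c \<cdot>\<^sub>v u + d \<cdot>\<^sub>v v) = c * (?x \<bullet> u) + d * (?x \<bullet> v)" for c d
    using assms by (simp add: scalar_prod_add_distrib[of _ n])
  have "?x \<in> dual_code n (plane u v) \<longleftrightarrow> (\<forall>c d. c * (?x \<bullet> u) + d * (?x \<bullet> v) = 0)"
    using assms lin by (auto simp: dual_code_def plane_def) metis
  also have "\<dots> \<longleftrightarrow> ?x \<bullet> u = 0 \<and> ?x \<bullet> v = 0"
  proof
    assume *: "\<forall>c d. c * (?x \<bullet> u) + d * (?x \<bullet> v) = 0"
    show "?x \<bullet> u = 0 \<and> ?x \<bullet> v = 0"
      using *[rule_format, of 1 0] *[rule_format, of 0 1] by simp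
  qed simp
  finally show ?thesis by (simp only: xu xv)
qed

lemma cramer_zero:
  fixes p q r :: "'a :: idom"
  assumes "a * p + b * q = 0" "a * q + b * r = 0" "p * r - q\<^sup>2 \<noteq> 0"
  shows "a = 0 \<and> b = 0"
proof -
  have "a * (p * r - q\<^sup>2) = (a * p + b * q) * r - (a * q + b * r) * q"
    by (simp add: algebra_simps power2_eq_square)
  moreover have "b * (p * r - q\<^sup>2) = (a * q + b * r) * p - (a * p + b * q) * q"
    by (simp add: algebra_simps power2_eq_square)
  ultimately show ?thesis using assms by simp
qed

lemma indep_pair_if_gram_det:
  fixes u v :: "'a :: idom vec"
  assumes uv: "u \<in> carrier_vec n" "v \<in> carrier_vec n" and g: "gram_det u v \<noteq> 0"
  shows "indep_pair n u v"
  unfolding indep_pair_def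
proof (intro allI impI)
  fix a b assume "a \<cdot>\<^sub>v u + b \<cdot>\<^sub>v v = 0\<^sub>v n"
  moreover have "0\<^sub>v n \<in> dual_code n (plane u v)"
    using plane_closed[OF uv] by (auto simp: dual_code_def)
  ultimately have "a \<cdot>\<^sub>v u + b \<cdot>\<^sub>v v \<in> dual_code n (plane u v)" by simp
  then show "a = 0 \<and> b = 0"
    using cramer_zero[of a "u \<bullet> u" b "u \<bullet> v" "v \<bullet> v"] g
    by (simp add: orthogonal_to_plane_iff[OF uv] gram_det_def)
qed

text \<open>
  The intersection of the plane with its dual consists of the words whose coefficient vectors lie in
  the kernel of the Gram matrix.
\<close>

lemma LCD_plane_iff:
  fixes u v :: "'a :: idom vec"
  assumes uv: "u \<in> carrier_vec n" "v \<in> carrier_vec n" and ind: "indep_pair n u v"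
  shows "LCD n (plane u v) \<longleftrightarrow> gram_det u v \<noteq> 0"
proof
  assume lcd: "LCD n (plane u v)"
  have trivial: "a = 0 \<and> b = 0"
    if "a * (u \<bullet> u) + b * (u \<bullet> v) = 0" "a * (u \<bullet> v) + b * (v \<bullet> v) = 0" for a b
  proof -
    have "a \<cdot>\<^sub>v u + b \<cdot>\<^sub>v v \<in> plane u v \<inter> dual_code n (plane u v)"
      using that orthogonal_to_plane_iff[OF uv, of a b] by (auto simp: plane_def)
    with lcd have "a \<cdot>\<^sub>v u + b \<cdot>\<^sub>v v = 0\<^sub>v n" by (simp add: LCD_def)
    with ind show ?thesis by (simp add: indep_pair_def)
  qed
  show "gram_det u v \<noteq> 0"
  proof
    assume "gram_det u v = 0"
    then have det: "(u \<bullet> u) * (v \<bullet> v) = (u \<bullet> v) * (u \<bullet> v)"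
      by (simp add: gram_det_def power2_eq_square)
    \<comment> \<open>The columns of the adjugate of a singular Gram matrix lie in its kernel; if the adjugate
      vanishes, the Gram matrix itself is zero, and the kernel contains \<open>(1, 0)\<close>.\<close>
    have "v \<bullet> v = 0" "u \<bullet> v = 0"
      using trivial[of "v \<bullet> v" "- (u \<bullet> v)"] det by (auto simp: algebra_simps)
    moreover have "u \<bullet> u = 0"
      using trivial[of "- (u \<bullet> v)" "u \<bullet> u"] det by (auto simp: algebra_simps)
    ultimately show False using trivial[of 1 0] by simp
  qed
next
  assume g: "gram_det u v \<noteq> 0"
  have "x = 0\<^sub>v n" if x: "x \<in> plane u v" "x \<in> dual_code n (plane u v)" for x
  proof -
    from x(1) obtain a b where x_eq: "x = a \<cdot>\<^sub>v u + b \<cdot>\<^sub>v v" by (auto simp: plane_def)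
    with x(2) have "a = 0 \<and> b = 0"
      using cramer_zero[of a "u \<bullet> u" b "u \<bullet> v" "v \<bullet> v"] g
      by (simp add: orthogonal_to_plane_iff[OF uv] gram_det_def)
    with uv x_eq show ?thesis by auto
  qed
  moreover have "0\<^sub>v n = 0 \<cdot>\<^sub>v u + 0 \<cdot>\<^sub>v v" using uv by auto
  then have "0\<^sub>v n \<in> plane u v" unfolding plane_def by blast
  moreover have "0\<^sub>v n \<in> dual_code n (plane u v)"
    using plane_closed[OF uv] by (auto simp: dual_code_def)
  ultimately show "LCD n (plane u v)" unfolding LCD_def by blast
qed

text \<open>
  By default, simplification replaces 0, 1 and 2 by the constructors of the datatype, which defeats
  the rules for fields. The field with three elements is treated as an abstract field of
  characteristic 3 instead.
\<close>

declare zero_finite_3_def [simp del] one_finite_3_def [simp del] two_finite_3 [simp del]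

lemma gf3_arith [simp]:
  "(2 :: gf3) = - 1" "(3 :: gf3) = 0" "(- 1 :: gf3) \<noteq> 1" "(1 :: gf3) \<noteq> - 1"
proof -
  show two: "(2 :: gf3) = - 1"
    by (simp only: two_finite_3 one_finite_3_def uminus_finite_3_def finite_3.case)
  have "(3 :: gf3) = 2 + 1" by simp
  then show "(3 :: gf3) = 0" by (simp add: two)
  show "(- 1 :: gf3) \<noteq> 1" "(1 :: gf3) \<noteq> - 1"
    by (simp_all only: one_finite_3_def uminus_finite_3_def finite_3.case finite_3.distinct not_False_eq_True)
qed

section \<open>Ternary weights\<close>

lemma gf3_cases:
  obtains "x = (0 :: gf3)" | "x = 1" | "x = - 1"
  using UNIV_gf3 by blast

lemma hamming_weight_eq_sum:
  "hamming_weight v = (\<Sum>i<dim_vec v. if v $ i \<noteq> 0 then 1 else 0)"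
proof -
  have "{i. i < dim_vec v \<and> v $ i \<noteq> 0} = {..<dim_vec v} \<inter> {i. v $ i \<noteq> 0}" by auto
  then show ?thesis by (simp add: hamming_weight_def sum.If_cases)
qed

text \<open>The nonzero elements \<open>1\<close> and \<open>-1\<close> both have square 1, so each contributes 1 to \<open>v \<bullet> v\<close>.\<close>

lemma of_nat_hamming_weight:
  fixes v :: "gf3 vec"
  shows "of_nat (hamming_weight v) = v \<bullet> v"
proof -
  have sq: "x * x = (if x \<noteq> 0 then 1 else 0)" for x :: gf3
    by (cases x rule: gf3_cases) auto
  show ?thesis
    by (simp add: hamming_weight_eq_sum scalar_prod_def sq atLeast0LessThan if_distrib[of of_nat]
        cong: if_cong)
qed

text \<open>
  If \<open>(x, y)\<close> is not \<open>(0, 0)\<close>, exactly one of \<open>x\<close>, \<open>y\<close>, \<open>x + y\<close>, \<open>x - y\<close> vanishes; so \<open>k\<close> counts the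
  coordinates at which the two words do not both vanish.
\<close>

lemma four_weights_sum:
  fixes u v :: "gf3 vec"
  assumes "u \<in> carrier_vec n" "v \<in> carrier_vec n"
  obtains k where "k \<le> n"
    "hamming_weight u + hamming_weight v + hamming_weight (u + v) + hamming_weight (u - v) = 3 * k"
proof
  let ?nz = "\<lambda>x :: gf3. if x \<noteq> 0 then 1 else 0 :: nat"
  let ?k = "\<Sum>i<n. if u $ i \<noteq> 0 \<or> v $ i \<noteq> 0 then 1 else 0 :: nat"
  have point: "?nz x + ?nz y + ?nz (x + y) + ?nz (x - y) = 3 * (if x \<noteq> 0 \<or> y \<noteq> 0 then 1 else 0)"
    for x y
    by (cases x rule: gf3_cases; cases y rule: gf3_cases) auto
  have w: "hamming_weight u = (\<Sum>i<n. ?nz (u $ i))" "hamming_weight v = (\<Sum>i<n. ?nz (v $ i))"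
    "hamming_weight (u + v) = (\<Sum>i<n. ?nz (u $ i + v $ i))"
    "hamming_weight (u - v) = (\<Sum>i<n. ?nz (u $ i - v $ i))"
    using assms by (auto simp: hamming_weight_eq_sum intro!: sum.cong)
  show "hamming_weight u + hamming_weight v + hamming_weight (u + v) + hamming_weight (u - v)
      = 3 * ?k"
    by (simp only: w point sum_distrib_left flip: sum.distrib)
  have "?k \<le> (\<Sum>i<n. 1)" by (intro sum_mono) auto
  then show "?k \<le> n" by simp
qed

text \<open>
  Since \<open>2 = -1\<close>, polarization reads \<open>u \<bullet> v = u \<bullet> u + v \<bullet> v - (u + v) \<bullet> (u + v)\<close>.
\<close>

lemma gram_det_eq_weights:
  fixes u v :: "gf3 vec"
  assumes uv: "u \<in> carrier_vec n" "v \<in> carrier_vec n"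
  shows "gram_det u v = of_nat (hamming_weight u) * of_nat (hamming_weight v) -
    (of_nat (hamming_weight u) + of_nat (hamming_weight v) - of_nat (hamming_weight (u + v)))\<^sup>2"
proof -
  have "(u + v) \<bullet> (u + v) = u \<bullet> u + v \<bullet> v + 2 * (u \<bullet> v)"
    using uv comm_scalar_prod[OF uv]
    by (simp add: add_scalar_prod_distrib[of _ n] scalar_prod_add_distrib[of _ n] algebra_simps)
  then have "u \<bullet> v = u \<bullet> u + v \<bullet> v - (u + v) \<bullet> (u + v)" by simp
  then show ?thesis by (simp add: gram_det_def of_nat_hamming_weight)
qed

section \<open>The upper bound\<close>

definition optimal_weight :: "nat \<Rightarrow> nat" where
  "optimal_weight n = (if n mod 4 = 1 \<or> n mod 4 = 2 then 3 * n div 4 else 3 * n div 4 - 1)"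

text \<open>
  When the minimum is \<open>\<lfloor>3 n / 4\<rfloor>\<close> and \<open>n\<close> is 0 or 3 modulo 4, the sum of the four weights leaves
  so little room that their residues modulo 3 are known, and these make the Gram determinant vanish.
\<close>

lemma min_weight_le:
  fixes u v :: "gf3 vec"
  assumes uv: "u \<in> carrier_vec n" "v \<in> carrier_vec n" and g: "gram_det u v \<noteq> 0"
    and d: "d \<le> hamming_weight u" "d \<le> hamming_weight v"
      "d \<le> hamming_weight (u + v)" "d \<le> hamming_weight (u - v)"
  shows "d \<le> optimal_weight n"
proof -
  obtain k where k: "k \<le> n"
    and sum: "hamming_weight u + hamming_weight v + hamming_weight (u + v) + hamming_weight (u - v)
      = 3 * k"
    using four_weights_sum[OF uv] .
  have le: "d \<le> 3 * n div 4" using d k sum by linarith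
  have "d \<noteq> 3 * n div 4" if "n mod 4 = 0 \<or> n mod 4 = 3"
  proof
    assume d_eq: "d = 3 * n div 4"
    define m where "m = n div 4"
    show False
    proof (cases "n mod 4 = 0")
      case True
      then have "n = 4 * m" unfolding m_def by presburger
      moreover from this have "d = 3 * m" using d_eq by simp
      ultimately have "hamming_weight u = 3 * m" "hamming_weight v = 3 * m" "hamming_weight (u + v) = 3 * m"
        using d k sum by linarith+
      with g show False by (simp add: gram_det_eq_weights[OF uv])
    next
      case False
      with that have n: "n = 4 * m + 3" unfolding m_def by presburger
      then have d': "d = 3 * m + 2" using d_eq by simp
      have "12 * m + 8 \<le> 3 * k" using d sum unfolding d' by linarith
      then have "k = n" using k unfolding n by linarith
      then have total: "hamming_weight u + hamming_weight v + hamming_weight (u + v)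
          + hamming_weight (u - v) = 12 * m + 9"
        using sum n by simp
      \<comment> \<open>The excesses of the four weights over \<open>d = 3 m + 2\<close> add up to 1; modulo 3, a weight
        \<open>d + e\<close> is \<open>e - 1\<close>.\<close>
      from d obtain e1 e2 e3 e4 where e: "hamming_weight u = d + e1" "hamming_weight v = d + e2"
        "hamming_weight (u + v) = d + e3" "hamming_weight (u - v) = d + e4"
        unfolding le_iff_add by blast
      with total have "e1 + e2 + e3 + e4 = 1" unfolding d' by linarith
      then have "e1 = 1 \<and> e2 = 0 \<and> e3 = 0 \<or> e1 = 0 \<and> e2 = 1 \<and> e3 = 0 \<or>
          e1 = 0 \<and> e2 = 0 \<and> e3 = 1 \<or> e1 = 0 \<and> e2 = 0 \<and> e3 = 0"
        by (simp add: add_is_1) blast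
      moreover have "of_nat (d + i) = (of_nat i - 1 :: gf3)" for i
        unfolding d' by simp
      ultimately have "gram_det u v = 0"
        unfolding gram_det_eq_weights[OF uv] e by auto
      with g show False ..
    qed
  qed
  moreover have "n mod 4 < 4" by simp
  then have "n mod 4 = 0 \<or> n mod 4 = 1 \<or> n mod 4 = 2 \<or> n mod 4 = 3" by linarith
  ultimately show ?thesis
    using le by (elim disjE) (simp_all add: optimal_weight_def)
qed

section \<open>Optimal generating pairs\<close>

lemma hamming_weight_vCons:
  "hamming_weight (vCons a v) = (if a \<noteq> 0 then 1 else 0) + hamming_weight v"
  unfolding hamming_weight_eq_sum dim_vec_vCons sum.lessThan_Suc_shift by simp

lemma vCons_add: "dim_vec v = dim_vec w \<Longrightarrow> vCons a v + vCons b w = vCons (a + b) (v + w)"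
  by (intro eq_vecI) (auto simp: vec_index_vCons)

lemma vCons_minus: "dim_vec v = dim_vec w \<Longrightarrow> vCons a v - vCons b w = vCons (a - b) (v - w)"
  by (intro eq_vecI) (auto simp: vec_index_vCons)

text \<open>
  The base pairs have the columns \<open>(1,0)\<close>, \<open>(0,1)\<close>, \<open>(1,1)\<close> with multiplicities \<open>1,1,0\<close>; \<open>1,1,0\<close> and
  a zero column; \<open>2,1,1\<close>; and \<open>2,2,1\<close>. Prepending one column for each of the four points of the
  projective line over the field with three elements prepends a word of the tetracode to each word.
\<close>

lemma optimal_pair_exists:
  assumes "n \<ge> 2"
  shows "\<exists>u v :: gf3 vec. u \<in> carrier_vec n \<and> v \<in> carrier_vec n \<and> gram_det u v \<noteq> 0 \<and>
    (\<forall>w \<in> {u, v, u + v, u - v}. optimal_weight n \<le> hamming_weight w)"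
  using assms
proof (induction n rule: less_induct)
  case (less n)
  have vNil: "hamming_weight vNil = 0" "vNil + vNil = vNil" "vNil - vNil = vNil"
    by (auto simp: hamming_weight_def)
  note weights = vNil hamming_weight_vCons vCons_add vCons_minus
  consider "n = 2" | "n = 3" | "n = 4" | "n = 5" | "n \<ge> 6" using less.prems by linarith
  then show ?case
  proof cases
    case 1
    show ?thesis
      unfolding 1
      by (rule exI[of _ "vec_of_list [1, 0]"], rule exI[of _ "vec_of_list [0, 1]"])
        (simp add: weights gram_det_def optimal_weight_def carrier_vecI)
  next
    case 2
    show ?thesis
      unfolding 2
      by (rule exI[of _ "vec_of_list [1, 0, 0]"], rule exI[of _ "vec_of_list [0, 1, 0]"])
        (simp add: weights gram_det_def optimal_weight_def carrier_vecI)
  next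
    case 3
    show ?thesis
      unfolding 3
      by (rule exI[of _ "vec_of_list [1, 1, 0, 1]"], rule exI[of _ "vec_of_list [0, 0, 1, 1]"])
        (simp add: weights gram_det_def optimal_weight_def carrier_vecI)
  next
    case 4
    show ?thesis
      unfolding 4
      by (rule exI[of _ "vec_of_list [1, 1, 0, 0, 1]"], rule exI[of _ "vec_of_list [0, 0, 1, 1, 1]"])
        (simp add: weights gram_det_def optimal_weight_def carrier_vecI)
  next
    case 5
    then have "n - 4 < n" "n - 4 \<ge> 2" by simp_all
    from less.IH[OF this] obtain u v :: "gf3 vec" where
      uv: "u \<in> carrier_vec (n - 4)" "v \<in> carrier_vec (n - 4)" and g: "gram_det u v \<noteq> 0" and
      w: "\<forall>w \<in> {u, v, u + v, u - v}. optimal_weight (n - 4) \<le> hamming_weight w"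
      by blast
    \<comment> \<open>The prepended words \<open>1011\<close> and \<open>011(-1)\<close>, their sum and their difference have weight 3, and
      the Gram matrix of the two words is zero.\<close>
    define u' where "u' = vCons 1 (vCons 0 (vCons 1 (vCons 1 u)))"
    define v' where "v' = vCons 0 (vCons 1 (vCons 1 (vCons (- 1) v)))"
    have dims: "dim_vec u = dim_vec v" "n = Suc (Suc (Suc (Suc (n - 4))))"
      using uv 5 by auto
    have carr: "u' \<in> carrier_vec n" "v' \<in> carrier_vec n"
      by (subst dims(2), simp add: u'_def v'_def uv)+
    have "u' \<bullet> u' = u \<bullet> u" "v' \<bullet> v' = v \<bullet> v" "u' \<bullet> v' = u \<bullet> v"
      by (simp_all add: u'_def v'_def)
    then have g': "gram_det u' v' \<noteq> 0" using g by (simp add: gram_det_def)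
    have "hamming_weight u' = 3 + hamming_weight u" "hamming_weight v' = 3 + hamming_weight v"
      "hamming_weight (u' + v') = 3 + hamming_weight (u + v)"
      "hamming_weight (u' - v') = 3 + hamming_weight (u - v)"
      by (simp_all add: u'_def v'_def weights dims(1))
    moreover have "optimal_weight n = 3 + optimal_weight (n - 4)"
    proof -
      define j where "j = n - 4"
      then have "n = j + 4" "j \<ge> 2" using 5 by simp_all
      moreover have "3 * (j + 4) div 4 = 3 * j div 4 + 3" by (simp add: algebra_simps)
      moreover have "1 \<le> 3 * j div 4" using \<open>j \<ge> 2\<close> by linarith
      ultimately show ?thesis by (auto simp: optimal_weight_def simp del: mult_Suc_right distrib_left_numeral)
    qed
    ultimately have "\<forall>w \<in> {u', v', u' + v', u' - v'}. optimal_weight n \<le> hamming_weight w"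
      using w by auto
    with carr g' show ?thesis by blast
  qed
qed

section \<open>From generating pairs to codes\<close>

lemma hamming_weight_uminus:
  fixes v :: "'a :: group_add vec"
  shows "hamming_weight (- v) = hamming_weight v"
  by (simp add: hamming_weight_eq_sum)

text \<open>Up to sign, these four words are all nonzero combinations of \<open>u\<close> and \<open>v\<close>.\<close>

lemma plane_nonzero_weight:
  fixes u v :: "gf3 vec"
  assumes uv: "u \<in> carrier_vec n" "v \<in> carrier_vec n" and x: "x \<in> plane u v" "x \<noteq> 0\<^sub>v n"
  shows "\<exists>w \<in> {u, v, u + v, u - v}. hamming_weight x = hamming_weight w"
proof -
  from x obtain a b where x_eq: "x = a \<cdot>\<^sub>v u + b \<cdot>\<^sub>v v" by (auto simp: plane_def)
  have smult: "0 \<cdot>\<^sub>v w = 0\<^sub>v n" "1 \<cdot>\<^sub>v w = w" "(- 1) \<cdot>\<^sub>v w = - w" if "w \<in> carrier_vec n" for w :: "gf3 vec"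
    using that by (intro eq_vecI; simp)+
  have sum: "- u + v = - (u - v)" "- u + - v = - (u + v)" "u + - v = u - v"
    using uv by (intro eq_vecI; simp)+
  from x(2) uv show ?thesis
    unfolding x_eq
    by (cases a rule: gf3_cases; cases b rule: gf3_cases)
      (simp_all add: smult sum hamming_weight_uminus)
qed

lemma finite_carrier_vec: "finite (carrier_vec n :: 'a :: finite vec set)"
proof -
  have "carrier_vec n \<subseteq> vec_of_list ` {xs :: 'a list. set xs \<subseteq> UNIV \<and> length xs = n}"
  proof
    fix v :: "'a vec" assume "v \<in> carrier_vec n"
    then show "v \<in> vec_of_list ` {xs. set xs \<subseteq> UNIV \<and> length xs = n}"
      by (intro image_eqI[of _ _ "list_of_vec v"]) (auto simp: vec_list)
  qed
  then show ?thesis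
    by (rule finite_subset) (intro finite_imageI finite_lists_length_eq finite)
qed

lemma ternary_LCD_2_weight_le:
  assumes code: "ternary_code n 2 d C" and lcd: "LCD n C"
  shows "d \<le> optimal_weight n"
proof -
  interpret vec_space "TYPE(gf3)" n .
  have sub: "subspace class_ring C V" and dim: "vectorspace.dim class_ring (V\<lparr>carrier := C\<rparr>) = 2"
    and min: "\<forall>c \<in> C - {0\<^sub>v n}. d \<le> hamming_weight c"
    using code by (simp_all add: ternary_code_def has_min_weight_def)
  from sub have "C \<subseteq> carrier_vec n" by (auto simp: subspace_def submodule_def)
  then have "finite C" using finite_carrier_vec by (rule finite_subset)
  from two_dim_subspace_is_plane[OF sub dim this] obtain u v where
    uv: "u \<in> carrier_vec n" "v \<in> carrier_vec n" and ind: "indep_pair n u v" and C: "C = plane u v" .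
  have word: "d \<le> hamming_weight (a \<cdot>\<^sub>v u + b \<cdot>\<^sub>v v)" if "a \<noteq> 0 \<or> b \<noteq> 0" for a b
  proof -
    have "a \<cdot>\<^sub>v u + b \<cdot>\<^sub>v v \<in> C" unfolding C plane_def by blast
    moreover have "a \<cdot>\<^sub>v u + b \<cdot>\<^sub>v v \<noteq> 0\<^sub>v n" using that ind by (auto simp: indep_pair_def)
    ultimately show ?thesis using min by blast
  qed
  have "u = 1 \<cdot>\<^sub>v u + 0 \<cdot>\<^sub>v v" "v = 0 \<cdot>\<^sub>v u + 1 \<cdot>\<^sub>v v" "u + v = 1 \<cdot>\<^sub>v u + 1 \<cdot>\<^sub>v v"
    "u - v = 1 \<cdot>\<^sub>v u + (- 1) \<cdot>\<^sub>v v"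
    using uv by (intro eq_vecI; simp)+
  then have "d \<le> hamming_weight u" "d \<le> hamming_weight v" "d \<le> hamming_weight (u + v)"
      "d \<le> hamming_weight (u - v)"
    using word[of 1 0] word[of 0 1] word[of 1 1] word[of 1 "- 1"] by simp_all
  moreover have "gram_det u v \<noteq> 0" using lcd LCD_plane_iff[OF uv ind] C by simp
  ultimately show ?thesis using min_weight_le[OF uv] by blast
qed

text \<open>
  The minimum weight of the code built from an optimal pair need only be bounded from below here; that
  it is not larger follows from the upper bound for all codes.
\<close>

lemma ternary_LCD_2_exists:
  assumes "n \<ge> 2"
  obtains d C where "ternary_code n 2 d C" "LCD n C" "optimal_weight n \<le> d"
proof -
  interpret vec_space "TYPE(gf3)" n .
  obtain u v :: "gf3 vec" where uv: "u \<in> carrier_vec n" "v \<in> carrier_vec n"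
    and g: "gram_det u v \<noteq> 0"
    and w: "\<forall>w \<in> {u, v, u + v, u - v}. optimal_weight n \<le> hamming_weight w"
    using optimal_pair_exists[OF assms] by blast
  have ind: "indep_pair n u v" by (rule indep_pair_if_gram_det[OF uv g])
  let ?N = "plane u v - {0\<^sub>v n}"
  define d where "d = (LEAST k. k \<in> hamming_weight ` ?N)"
  have "1 \<cdot>\<^sub>v u + 0 \<cdot>\<^sub>v v \<in> ?N"
    using ind unfolding plane_def indep_pair_def
    by (metis (mono_tags, lifting) DiffI mem_Collect_eq singletonD zero_neq_one)
  then have "d \<in> hamming_weight ` ?N"
    unfolding d_def by (intro LeastI[of "\<lambda>k. k \<in> hamming_weight ` ?N"]) (rule imageI)
  then obtain c where c: "c \<in> ?N" "hamming_weight c = d" by auto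
  have "d \<le> hamming_weight c'" if "c' \<in> ?N" for c'
    unfolding d_def by (rule Least_le) (use that in blast)
  with c have "has_min_weight n (plane u v) d" by (auto simp: has_min_weight_def)
  then have "ternary_code n 2 d (plane u v)"
    using subspace_plane[OF uv ind] by (simp add: ternary_code_def)
  moreover have "LCD n (plane u v)" using LCD_plane_iff[OF uv ind] g by simp
  moreover have "optimal_weight n \<le> d"
    using plane_nonzero_weight[OF uv, of c] c w by auto
  ultimately show thesis by (rule that)
qed

theorem proposition7p2:
  fixes n :: nat
  assumes "n \<ge> 2"
  shows "int (d\<^sub>3 n 2) =
    (if n mod 4 = 1 \<or> n mod 4 = 2 then \<lfloor>3 * real n / 4\<rfloor> else \<lfloor>3 * real n / 4\<rfloor> - 1)"
proof -
  obtain d C where dC: "ternary_code n 2 d C" "LCD n C" "optimal_weight n \<le> d"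
    using ternary_LCD_2_exists[OF assms] .
  then have "d = optimal_weight n" using ternary_LCD_2_weight_le by (simp add: le_antisym)
  with dC have "d\<^sub>3 n 2 = optimal_weight n"
    unfolding d\<^sub>3_def
    by (intro Max_eqI finite_LCD_min_weights) (auto intro: ternary_LCD_2_weight_le)
  moreover have "\<lfloor>3 * real n / 4\<rfloor> = int (3 * n div 4)"
    using floor_divide_of_nat_eq[of "3 * n" 4, where ?'a = real] by simp
  moreover have "1 \<le> 3 * n div 4" using assms by simp
  ultimately show ?thesis by (simp add: optimal_weight_def of_nat_diff)
qed

end
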